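(* Let $p$ be a prime, let $s \geq 1$ be an integer, and let $q = p^s$. Let $P, Q \in \mathbb{Z}[x_1,\ldots,x_N]$ be polynomials which are each linear in each variable and which have every non-zero coefficient equal to $1$. Then $$[(x_1\cdots x_N)^{q-1}]\,(PQ)^{q-1} \equiv \Bigl([(x_1\cdots x_N)^{p-1}]\,(PQ)^{p-1}\Bigr)^s \pmod p .$$
   Context: For a monomial $m$ and a polynomial $F$, $[m]F$ denotes the coefficient of $m$ in $F$. A polynomial is "linear in each variable" if its degree in each individual variable is at most $1$ (no homogeneity is required). *)

theory Defs
  imports Complex_Main "HOL-Library.Poly_Mapping" "HOL-Number_Theory.Cong"
    "HOL-Computational_Algebra.Primes"
begin

text \<open>
  A monomial is its exponent vector: a finitely supported map from variable indices to exponents.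
  A polynomial is a finitely supported map from monomials to coefficients, with the convolution
  product of \<^theory>\<open>HOL-Library.Poly_Mapping\<close>. The variables \<open>x\<^sub>1, \<dots>, x\<^sub>N\<close> have the
  indices \<open>1, \<dots>, N\<close>.
\<close>

type_synonym monom = "nat \<Rightarrow>\<^sub>0 nat"
type_synonym 'a mpoly = "monom \<Rightarrow>\<^sub>0 'a"

definition polys_in :: "nat \<Rightarrow> 'a::zero mpoly set" where
  "polys_in N = {F. \<forall>m \<in> Poly_Mapping.keys F. Poly_Mapping.keys m \<subseteq> {1..N}}"

definition coeff_of :: "monom \<Rightarrow> 'a::zero mpoly \<Rightarrow> 'a" where
  "coeff_of m F = Poly_Mapping.lookup F m"

text \<open>The zero polynomial gets degree 0 in every variable.\<close>

definition degree_in :: "nat \<Rightarrow> 'a::zero mpoly \<Rightarrow> nat" where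
  "degree_in i F = Max (insert 0 ((\<lambda>m. Poly_Mapping.lookup m i) ` Poly_Mapping.keys F))"

definition linear_in_each_variable :: "nat \<Rightarrow> 'a::zero mpoly \<Rightarrow> bool" where
  "linear_in_each_variable N F \<longleftrightarrow> (\<forall>i \<in> {1..N}. degree_in i F \<le> 1)"

definition nonzero_coeffs_one :: "'a::zero_neq_one mpoly \<Rightarrow> bool" where
  "nonzero_coeffs_one F \<longleftrightarrow> (\<forall>m. coeff_of m F \<noteq> 0 \<longrightarrow> coeff_of m F = 1)"

text \<open>The monomial \<open>(x\<^sub>1 \<cdots> x\<^sub>N)\<^sup>k\<close>; adding exponent vectors multiplies monomials.\<close>

definition all_vars_power :: "nat \<Rightarrow> nat \<Rightarrow> monom" where
  "all_vars_power N k = (\<Sum>i\<in>{1..N}. Poly_Mapping.single i k)"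

end

theory Submission
  imports Defs "HOL-Number_Theory.Residues"
begin

text \<open>
  Put \<open>F = P Q\<close>, a polynomial of degree at most 2 in each variable. From
  \<open>p\<^sup>s\<^sup>+\<^sup>1 - 1 = (p - 1) + p (p\<^sup>s - 1)\<close> and the Frobenius congruence
  \<open>G(x)\<^sup>p \<equiv> G(x\<^sup>p)\<close> modulo \<open>p\<close>, one gets that \<open>F\<close> to the power \<open>p\<^sup>s\<^sup>+\<^sup>1 - 1\<close> is congruent to
  \<open>F(x)\<^sup>p\<^sup>-\<^sup>1 G(x\<^sup>p)\<close>, where \<open>G\<close> is \<open>F\<close> to the power \<open>p\<^sup>s - 1\<close>. In the first factor all
  exponents are at most \<open>2p - 2\<close>, so the only one congruent to \<open>p - 1\<close> modulo \<open>p\<close> is \<open>p - 1\<close>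
  itself. Hence a single pair of monomials contributes to the coefficient, which therefore
  factors, and the claim follows by induction on \<open>s\<close>.
\<close>

text \<open>For 0 < k < p the prime \<open>p\<close> divides \<open>p choose k\<close>, which
  settles two summands; induction on \<open>S\<close> does the rest. The ring is arbitrary so that a
  polynomial split into its terms can be inserted.\<close>

lemma of_nat_dvd_sum_power_prime:
  fixes f :: "'b \<Rightarrow> 'a::comm_ring_1"
  assumes p: "prime p" and "finite S"
  shows "of_nat p dvd (\<Sum>x\<in>S. f x) ^ p - (\<Sum>x\<in>S. f x ^ p)"
proof -
  have add: "of_nat p dvd (a + b) ^ p - (a ^ p + b ^ p)" for a b :: 'a
  proof -
    let ?t = "\<lambda>k. of_nat (p choose k) * a ^ k * b ^ (p - k)"
    have "{..p} = insert 0 (insert p {1..<p})" using prime_gt_0_nat[OF p] by auto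
    then have "(a + b) ^ p = b ^ p + (a ^ p + (\<Sum>k\<in>{1..<p}. ?t k))"
      using prime_gt_0_nat[OF p] by (simp add: binomial_ring)
    moreover have "of_nat p dvd (\<Sum>k\<in>{1..<p}. ?t k)"
    proof (rule dvd_sum)
      fix k assume "k \<in> {1..<p}"
      then have "p dvd p choose k" using p by (intro dvd_choose_prime) auto
      then have "(of_nat p :: 'a) dvd of_nat (p choose k)" by (metis dvd_def of_nat_mult)
      then show "of_nat p dvd ?t k" by (simp add: mult.assoc)
    qed
    ultimately show ?thesis by (simp add: algebra_simps)
  qed
  show ?thesis
    using \<open>finite S\<close>
  proof (induction S rule: finite_induct)
    case empty
    then show ?case using prime_gt_0_nat[OF p] by (simp add: power_0_left)
  next
    case (insert x S)
    have "(\<Sum>x\<in>insert x S. f x) ^ p - (\<Sum>x\<in>insert x S. f x ^ p)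
        = ((f x + sum f S) ^ p - (f x ^ p + sum f S ^ p))
          + (sum f S ^ p - (\<Sum>x\<in>S. f x ^ p))"
      using insert by simp
    then show ?case using add insert.IH by (metis dvd_add)
  qed
qed

text \<open>Fermat's little theorem, with multiples of \<open>p\<close> included. It is what makes
  the coefficients of a polynomial survive the p-th power unchanged modulo \<open>p\<close>.\<close>

lemma prime_dvd_power_diff_self:
  fixes a :: int
  assumes p: "prime p"
  shows "int p dvd a ^ p - a"
proof -
  \<comment> \<open>\<open>fermat_theorem\<close> is about natural numbers, so \<open>a\<close> is
    replaced by its least nonnegative residue.\<close>
  define n where "n = nat (a mod int p)"
  have "p > 0" using p by (rule prime_gt_0_nat)
  then have n: "[a = int n] (mod int p)"
    by (simp add: n_def cong_def)
  have "[n ^ p = n] (mod p)"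
  proof (cases "p dvd n")
    case True
    then show ?thesis using \<open>p > 0\<close> by (meson cong_0_iff cong_sym cong_trans dvd_power dvd_trans)
  next
    case False
    then have "[n ^ (p - 1) * n = 1 * n] (mod p)"
      using fermat_theorem[OF p False] by (intro cong_mult) auto
    then show ?thesis using \<open>p > 0\<close> by (metis mult_1 power_minus_mult)
  qed
  then have "[int n ^ p = int n] (mod int p)" by (metis cong_int_iff of_nat_power)
  then have "[a ^ p = a] (mod int p)"
    using n by (meson cong_pow cong_sym cong_trans)
  then show ?thesis by (simp add: cong_iff_dvd_diff)
qed

text \<open>Since monomials multiply by adding exponents, this is the n-th power of the monomial
  \<open>m\<close>.\<close>

definition scale_monom :: "nat \<Rightarrow> monom \<Rightarrow> monom" where
  "scale_monom n m = Poly_Mapping.map ((*) n) m"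

lemma lookup_scale_monom [simp]:
  "Poly_Mapping.lookup (scale_monom n m) i = n * Poly_Mapping.lookup m i"
  by (simp add: scale_monom_def map.rep_eq when_def)

lemma single_power:
  fixes c :: "'a::comm_semiring_1"
  shows "Poly_Mapping.single m c ^ n = Poly_Mapping.single (scale_monom n m) (c ^ n)"
proof (induction n)
  case 0
  have "scale_monom 0 m = 0" by (rule poly_mapping_eqI) simp
  then show ?case by simp
next
  case (Suc n)
  have "m + scale_monom n m = scale_monom (Suc n) m"
    by (rule poly_mapping_eqI) (simp add: lookup_add)
  with Suc show ?case by (simp add: mult_single)
qed

lemma poly_mapping_eq_sum_single:
  "F = (\<Sum>m\<in>Poly_Mapping.keys F. Poly_Mapping.single m (Poly_Mapping.lookup F m))"
  by (rule poly_mapping_eqI)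
    (auto simp: lookup_sum lookup_single when_def in_keys_iff)

text \<open>In the polynomial ring \<open>of_nat n\<close> is the constant \<open>n\<close>, so
  multiplying by it scales every coefficient. This turns congruences of polynomials into congruences
  of coefficients.\<close>

lemma dvd_lookup_of_nat_mult:
  fixes H :: "'b::comm_monoid_add \<Rightarrow>\<^sub>0 'a::comm_semiring_1"
  assumes "of_nat n dvd H"
  shows "of_nat n dvd Poly_Mapping.lookup H m"
proof -
  obtain K where "H = of_nat n * K" using assms by (auto simp: dvd_def)
  moreover have "Poly_Mapping.lookup (of_nat n * K) m = of_nat n * Poly_Mapping.lookup K m"
    by (induction n) (auto simp: distrib_right lookup_add)
  ultimately show ?thesis by simp
qed

text \<open>The polynomial G(x^p), obtained by substituting x_i^p for every variable x_i.\<close>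

definition frob :: "nat \<Rightarrow> 'a::comm_monoid_add mpoly \<Rightarrow> 'a mpoly" where
  "frob p G = (\<Sum>m\<in>Poly_Mapping.keys G.
     Poly_Mapping.single (scale_monom p m) (Poly_Mapping.lookup G m))"

text \<open>Modulo \<open>p\<close>, the p-th power is additive over the terms of \<open>G\<close>
  (fact 1), and on a single term it scales the exponents and fixes the coefficient by Fermat (fact
  2).\<close>

lemma power_prime_cong_frob:
  fixes G :: "int mpoly"
  assumes p: "prime p"
  shows "of_nat p dvd G ^ p - frob p G"
proof -
  let ?c = "Poly_Mapping.lookup G"
  let ?K = "Poly_Mapping.keys G"
  have 1: "of_nat p dvd G ^ p - (\<Sum>m\<in>?K. Poly_Mapping.single m (?c m) ^ p)"
    using of_nat_dvd_sum_power_prime[OF p, of ?K "\<lambda>m. Poly_Mapping.single m (?c m)"]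
    by (simp flip: poly_mapping_eq_sum_single)
  have 2: "of_nat p dvd (\<Sum>m\<in>?K. Poly_Mapping.single m (?c m) ^ p) - frob p G"
    unfolding frob_def sum_subtractf[symmetric]
  proof (rule dvd_sum)
    fix m
    obtain k where "?c m ^ p - ?c m = int p * k"
      using prime_dvd_power_diff_self[OF p, of "?c m"] by (auto simp: dvd_def)
    then have "Poly_Mapping.single m (?c m) ^ p - Poly_Mapping.single (scale_monom p m) (?c m)
        = of_nat p * Poly_Mapping.single (scale_monom p m) k"
      by (simp add: single_power mult_single flip: single_diff single_of_nat)
    then show "of_nat p dvd
        Poly_Mapping.single m (?c m) ^ p - Poly_Mapping.single (scale_monom p m) (?c m)"
      by simp
  qed
  show ?thesis using dvd_add[OF 1 2] by simp
qed

lemma lookup_mult_frob: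
  fixes A G :: "'a::comm_semiring_1 mpoly"
  shows "Poly_Mapping.lookup (A * frob p G) M =
    (\<Sum>(a, m)\<in>Poly_Mapping.keys A \<times> Poly_Mapping.keys G.
      Poly_Mapping.lookup A a * Poly_Mapping.lookup G m when a + scale_monom p m = M)"
proof -
  have "A * frob p G = (\<Sum>a\<in>Poly_Mapping.keys A.
      Poly_Mapping.single a (Poly_Mapping.lookup A a)) * frob p G"
    by (simp flip: poly_mapping_eq_sum_single)
  also have "\<dots> = (\<Sum>(a, m)\<in>Poly_Mapping.keys A \<times> Poly_Mapping.keys G.
      Poly_Mapping.single (a + scale_monom p m)
        (Poly_Mapping.lookup A a * Poly_Mapping.lookup G m))"
    by (simp add: frob_def sum_product mult_single sum.cartesian_product)
  finally show ?thesis by (simp add: lookup_sum lookup_single case_prod_unfold)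
qed

lemma lookup_all_vars_power [simp]:
  "Poly_Mapping.lookup (all_vars_power N k) i = (if i \<in> {1..N} then k else 0)"
  by (auto simp: all_vars_power_def lookup_sum lookup_single when_def)

definition degrees_le :: "nat \<Rightarrow> nat \<Rightarrow> 'a::zero mpoly \<Rightarrow> bool" where
  "degrees_le N d F \<longleftrightarrow>
    (\<forall>m\<in>Poly_Mapping.keys F. \<forall>i\<in>{1..N}. Poly_Mapping.lookup m i \<le> d)"

lemma linear_imp_degrees_le:
  assumes "linear_in_each_variable N F"
  shows "degrees_le N 1 F"
  using assms by (auto simp: linear_in_each_variable_def degree_in_def degrees_le_def)

lemma degrees_le_mult:
  fixes F G :: "'a::semiring_0 mpoly"
  assumes "degrees_le N d F" and "degrees_le N e G"
  shows "degrees_le N (d + e) (F * G)"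
  unfolding degrees_le_def
proof (intro ballI)
  fix m i assume m: "m \<in> Poly_Mapping.keys (F * G)" and i: "i \<in> {1..N}"
  then obtain a b where "m = a + b" "a \<in> Poly_Mapping.keys F" "b \<in> Poly_Mapping.keys G"
    using keys_mult[of F G] by blast
  then show "Poly_Mapping.lookup m i \<le> d + e"
    using assms i unfolding degrees_le_def by (auto simp: lookup_add intro!: add_mono)
qed

lemma degrees_le_power:
  fixes F :: "'a::comm_semiring_1 mpoly"
  assumes "degrees_le N d F"
  shows "degrees_le N (n * d) (F ^ n)"
proof (induction n)
  case 0
  then show ?case by (auto simp: degrees_le_def)
next
  case (Suc n)
  then show ?case using degrees_le_mult[OF assms Suc] by simp
qed

text \<open>A comparison in each variable, like uniqueness of a base-p digit, except that the digit
  may range up to 2p - 2. Outside 1..N both exponents vanish because their weighted sum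
  does.\<close>

lemma all_vars_power_split_unique:
  assumes "p > 0" and "\<And>i. i \<in> {1..N} \<Longrightarrow> Poly_Mapping.lookup a i \<le> 2 * (p - 1)"
  shows "a + scale_monom p m = all_vars_power N ((p - 1) + p * r)
    \<longleftrightarrow> a = all_vars_power N (p - 1) \<and> m = all_vars_power N r"
proof
  assume "a + scale_monom p m = all_vars_power N ((p - 1) + p * r)"
  then have eq: "Poly_Mapping.lookup a i + p * Poly_Mapping.lookup m i
      = (if i \<in> {1..N} then (p - 1) + p * r else 0)" for i
    by (metis lookup_add lookup_scale_monom lookup_all_vars_power)
  have "Poly_Mapping.lookup a i = (if i \<in> {1..N} then p - 1 else 0) \<and>
      Poly_Mapping.lookup m i = (if i \<in> {1..N} then r else 0)" for i
  proof (cases "i \<in> {1..N}")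
    case False
    then show ?thesis using eq[of i] \<open>p > 0\<close> by auto
  next
    case True
    define x y where "x = Poly_Mapping.lookup a i" and "y = Poly_Mapping.lookup m i"
    have xy: "x + p * y = (p - 1) + p * r" using eq[of i] True by (simp add: x_def y_def)
    have x: "x \<le> 2 * (p - 1)" using assms(2)[OF True] by (simp add: x_def)
    have "y = r"
    proof (rule ccontr)
      assume "y \<noteq> r"
      then consider "r + 1 \<le> y" | "y + 1 \<le> r" by linarith
      then show False
      proof cases
        \<comment> \<open>Here x would be at most -1.\<close>
        case 1
        then have "p * (r + 1) \<le> p * y" by (rule mult_left_mono) simp
        then show False using xy \<open>p > 0\<close> by (simp add: distrib_left)
      next
        \<comment> \<open>Here x would be at least 2p - 1, just above the bound.\<close>
        case 2
        then have "p * (y + 1) \<le> p * r" by (rule mult_left_mono) simp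
        then show False using xy x \<open>p > 0\<close> by (simp add: distrib_left)
      qed
    qed
    then show ?thesis using xy True by (simp add: x_def y_def)
  qed
  then show "a = all_vars_power N (p - 1) \<and> m = all_vars_power N r"
    by (auto intro!: poly_mapping_eqI)
next
  assume "a = all_vars_power N (p - 1) \<and> m = all_vars_power N r"
  then show "a + scale_monom p m = all_vars_power N ((p - 1) + p * r)"
    by (auto intro!: poly_mapping_eqI simp: lookup_add)
qed

lemma lookup_mult_frob_all_vars_power:
  fixes A G :: "'a::comm_semiring_1 mpoly"
  assumes "p > 0" and "degrees_le N (2 * (p - 1)) A"
  shows "Poly_Mapping.lookup (A * frob p G) (all_vars_power N ((p - 1) + p * r)) =
    Poly_Mapping.lookup A (all_vars_power N (p - 1)) *
    Poly_Mapping.lookup G (all_vars_power N r)"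
proof -
  let ?a = "all_vars_power N (p - 1)" and ?m = "all_vars_power N r"
  let ?f = "\<lambda>(a, m). Poly_Mapping.lookup A a * Poly_Mapping.lookup G m"
  let ?S = "Poly_Mapping.keys A \<times> Poly_Mapping.keys G"
  have "Poly_Mapping.lookup (A * frob p G) (all_vars_power N ((p - 1) + p * r)) =
      (\<Sum>z\<in>?S. if z = (?a, ?m) then ?f z else 0)"
    unfolding lookup_mult_frob
  proof (rule sum.cong)
    fix z assume "z \<in> ?S"
    moreover obtain a m where z: "z = (a, m)" by (cases z)
    ultimately have a: "\<And>i. i \<in> {1..N} \<Longrightarrow> Poly_Mapping.lookup a i \<le> 2 * (p - 1)"
      using assms(2) by (auto simp: degrees_le_def)
    have iff: "a + scale_monom p m = all_vars_power N ((p - 1) + p * r) \<longleftrightarrow> a = ?a \<and> m = ?m"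
      by (rule all_vars_power_split_unique) (use assms(1) a in auto)
    show "(case z of (a, m) \<Rightarrow> Poly_Mapping.lookup A a * Poly_Mapping.lookup G m
          when a + scale_monom p m = all_vars_power N ((p - 1) + p * r)) =
        (if z = (?a, ?m) then ?f z else 0)"
      unfolding z prod.case iff by (simp add: when_def)
  qed simp
  \<comment> \<open>If the pair \<open>(?a, ?m)\<close> is missing from \<open>?S\<close>, the sum
    is 0, and so is the product, since one of its coefficients vanishes.\<close>
  also have "\<dots> = ?f (?a, ?m)"
    by (auto simp: in_keys_iff)
  finally show ?thesis by simp
qed

lemma coeff_prime_power_cong:
  fixes F :: "int mpoly"
  assumes p: "prime p" and F: "degrees_le N 2 F"
  shows "[coeff_of (all_vars_power N (p ^ s - 1)) (F ^ (p ^ s - 1))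
          = (coeff_of (all_vars_power N (p - 1)) (F ^ (p - 1))) ^ s] (mod (int p))"
proof (induction s)
  case 0
  \<comment> \<open>For s = 0 both sides are 1: the left one is the constant coefficient of
    F^0.\<close>
  have "all_vars_power N 0 = 0" by (rule poly_mapping_eqI) simp
  then show ?case by (simp add: coeff_of_def)
next
  case (Suc s)
  let ?r = "p ^ s - 1"
  let ?G = "F ^ ?r" and ?M = "all_vars_power N (p ^ Suc s - 1)"
  have "p > 0" using p by (rule prime_gt_0_nat)
  have exp: "p ^ Suc s - 1 = (p - 1) + p * ?r"
  proof -
    \<comment> \<open>Subtraction of natural numbers truncates, so the identity needs this
      bound.\<close>
    have "p \<le> p * p ^ s" using \<open>p > 0\<close> by simp
    then show ?thesis using \<open>p > 0\<close> by (simp add: diff_mult_distrib2)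
  qed
  \<comment> \<open>By \<open>exp\<close> the large power of \<open>F\<close> equals F^(p-1) * G^p,
    and only the factor G^p is replaced by G(x^p).\<close>
  have "F ^ (p ^ Suc s - 1) - F ^ (p - 1) * frob p ?G
      = F ^ (p - 1) * (?G ^ p - frob p ?G)"
    unfolding exp power_add mult.commute[of p] power_mult right_diff_distrib ..
  then have "of_nat p dvd F ^ (p ^ Suc s - 1) - F ^ (p - 1) * frob p ?G"
    using power_prime_cong_frob[OF p] by simp
  from dvd_lookup_of_nat_mult[OF this, of ?M]
  have "[coeff_of ?M (F ^ (p ^ Suc s - 1)) = coeff_of ?M (F ^ (p - 1) * frob p ?G)] (mod int p)"
    by (simp add: cong_iff_dvd_diff coeff_of_def lookup_minus)
  \<comment> \<open>The same splitting \<open>exp\<close> now applies to the exponent in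
    \<open>?M\<close>; degree at most 2 in \<open>F\<close> gives the bound 2(p - 1) for
    F^(p-1).\<close>
  also have "coeff_of ?M (F ^ (p - 1) * frob p ?G)
      = coeff_of (all_vars_power N (p - 1)) (F ^ (p - 1)) * coeff_of (all_vars_power N ?r) ?G"
    unfolding exp coeff_of_def using \<open>p > 0\<close> degrees_le_power[OF F, of "p - 1"]
    by (intro lookup_mult_frob_all_vars_power) (simp_all add: mult.commute)
  also have "[\<dots> = coeff_of (all_vars_power N (p - 1)) (F ^ (p - 1)) ^ Suc s] (mod int p)"
    using cong_mult[OF cong_refl Suc.IH] by simp
  finally show ?case .
qed

theorem proposition1:
  fixes p s q N :: nat
    and P Q :: "int mpoly"
  assumes "prime p"
    and "s \<ge> 1"
    and "q = p ^ s"
    and "P \<in> polys_in N"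
    and "Q \<in> polys_in N"
    and "linear_in_each_variable N P"
    and "linear_in_each_variable N Q"
    and "nonzero_coeffs_one P"
    and "nonzero_coeffs_one Q"
  shows "[coeff_of (all_vars_power N (q - 1)) ((P * Q) ^ (q - 1))
          = (coeff_of (all_vars_power N (p - 1)) ((P * Q) ^ (p - 1))) ^ s] (mod (int p))"
proof -
  have "degrees_le N 2 (P * Q)"
    using degrees_le_mult[OF linear_imp_degrees_le linear_imp_degrees_le, of N P Q] assms(6,7)
    by (simp add: numeral_2_eq_2)
  then show ?thesis
    using coeff_prime_power_cong[OF assms(1)] assms(3) by blast
qed

end
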